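(* Let $\beta,\gamma\in[0,1)$ with $\beta+\gamma\le1$, $\eta\in\mathbb{R}$, and for $\alpha>2$ put $$e_{\mathrm{ISH}}=\min\{1+\gamma-\tfrac{\alpha(1-\beta)}2,\ \beta+\eta\},\quad e_{\mathrm{IMH}}=\min\{\beta+\gamma,\ \tfrac{1+\beta}2,\ \beta+\eta\},\quad e_{\mathrm{MH}}=\tfrac12,\quad e_{\mathrm{HC}}=2-\tfrac\alpha2,$$ and $e(\alpha,\beta,\gamma,\eta)=\max\{e_{\mathrm{ISH}},e_{\mathrm{IMH}},e_{\mathrm{MH}},e_{\mathrm{HC}}\}$. Say that $(\beta,\gamma)$ is of the following regime (for the given $\eta$) if for all $\alpha>2$ the value of $e$, and the scheme attaining it, are as listed: - Regime A: $e=2-\frac\alpha2$ (HC) for $2<\alpha<3$; $e=\frac12$ (MH) for $\alpha\ge3$. - Regime B: $e=2-\frac\alpha2$ (HC) for $2<\alpha<4-2\beta-2\gamma$; $e=\beta+\gamma$ (IMH) for $\alpha\ge4-2\beta-2\gamma$. - Regime C: $e=2-\frac\alpha2$ (HC) for $2<\alpha<3-\beta$; $e=\frac{1+\beta}2$ (IMH) for $\alpha\ge3-\beta$. - Regime D: $e=2-\frac\alpha2$ (HC) for $2<\alpha<\frac{2(1-\gamma)}\beta$; $e=1+\gamma-\frac{\alpha(1-\beta)}2$ (ISH) for $\frac{2(1-\gamma)}\beta\le\alpha<1+\frac{2\gamma}{1-\beta}$; $e=\frac{1+\beta}2$ (IMH) for $\alpha\ge1+\frac{2\gamma}{1-\beta}$.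 - Regime $\tilde{\mathrm B}$: $e=2-\frac\alpha2$ (HC) for $2<\alpha<4-2\beta-2\eta$; $e=\beta+\eta$ (IMH) for $\alpha\ge4-2\beta-2\eta$. - Regime $\tilde{\mathrm D}$: $e=2-\frac\alpha2$ (HC) for $2<\alpha<4-2\beta-2\eta$; $e=\beta+\eta$ (ISH) for $4-2\beta-2\eta\le\alpha<2+\frac{2(\gamma-\eta)}{1-\beta}$; $e=1+\gamma-\frac{\alpha(1-\beta)}2$ (ISH) for $2+\frac{2(\gamma-\eta)}{1-\beta}\le\alpha<1+\frac{2\gamma}{1-\beta}$; $e=\frac{1+\beta}2$ (IMH) for $\alpha\ge1+\frac{2\gamma}{1-\beta}$. Call the "infinite-capacity classification" the following: $\beta+\gamma<\frac12$: A; $\beta+\gamma\ge\frac12$ and $\beta+2\gamma<1$: B; $\beta+2\gamma\ge1$ and $\gamma<\frac12(\beta^2-3\beta+2)$: C; $\gamma\ge\frac12(\beta^2-3\beta+2)$: D. Then: 1. If $\eta<-\frac12$, every $(\beta,\gamma)$ is of Regime A. 2. If $-\frac12\le\eta<0$: $(\beta,\gamma)$ is of Regime A if $\beta<\frac12-\eta$, and of Regime $\tilde{\mathrm B}$ if $\beta\ge\frac12-\eta$. 3. If $0\le\eta<\frac12$: if $\beta+\gamma<\frac12$, Regime A. If $\beta+\gamma\ge\frac12$: (i) when $\gamma>\eta$ and $\beta<1-2\eta$, Regime A if $\beta<\frac12-\eta$ and Regime $\tilde{\mathrm B}$ if $\beta\ge\frac12-\eta$; (ii) when $\gamma\le\eta$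 and $\beta+2\gamma<1$, Regime B; (iii) when $\beta+2\gamma\ge1$, $\beta\ge1-2\eta$ and $\gamma\ge\beta^2+(\eta-2)\beta+1$, Regime $\tilde{\mathrm D}$; (iv) when $\beta+2\gamma\ge1$, $\beta\ge1-2\eta$ and $\gamma<\beta^2+(\eta-2)\beta+1$, the regime given by the infinite-capacity classification. 4. If $\frac12\le\eta<1$: Regime $\tilde{\mathrm D}$ if $\gamma\ge\beta^2+(\eta-2)\beta+1$; otherwise the regime given by the infinite-capacity classification. 5. If $\eta\ge1$: the regime given by the infinite-capacity classification for every $(\beta,\gamma)$.
   Context: Interpretation: a hybrid wireless network has $n$ ad hoc nodes at unit density, $m=n^\beta$ base stations with $l=n^\gamma$ antennas each, backhaul links of rate $R_{\mathrm{BS}}=n^\eta$ between each base station and a central processor, and path-loss exponent $\alpha>2$. The numbers $e_{\mathrm{ISH}},e_{\mathrm{IMH}},e_{\mathrm{MH}},e_{\mathrm{HC}}$ are the scaling exponents (powers of $n$, arbitrarily small $\epsilon$ terms omitted) of the total throughput achieved by four routing protocols: infrastructure-supported single-hop, infrastructure-supported multihop, pure multihop, and hierarchical cooperation. Listing a scheme next to a value of $e$ means that the exponent of this scheme equals $e$ for those $\alpha$ (other schemes may tie). An interval of $\alpha$ whose lower endpoint is not smaller than its upper endpoint is empty, and all conditions are to be intersected with $\alpha>2$. Regimes $\tilde{\mathrm B}$ and $\tilde{\mathrm D}$ are those in which the exponent depends on $\eta$ for some $\alpha$ ("infrastructure-limited"). *)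

theory Defs imports Complex_Main begin

text \<open>The four routing protocols: infrastructure-supported single-hop, infrastructure-supported
  multihop, pure multihop, hierarchical cooperation.\<close>

datatype scheme = ISH | IMH | MH | HC

fun exponent :: "scheme \<Rightarrow> real \<Rightarrow> real \<Rightarrow> real \<Rightarrow> real \<Rightarrow> real" where
  "exponent ISH \<alpha> \<beta> \<gamma> \<eta> = Min {1 + \<gamma> - \<alpha> * (1 - \<beta>) / 2, \<beta> + \<eta>}"
| "exponent IMH \<alpha> \<beta> \<gamma> \<eta> = Min {\<beta> + \<gamma>, (1 + \<beta>) / 2, \<beta> + \<eta>}"
| "exponent MH \<alpha> \<beta> \<gamma> \<eta> = 1 / 2"
| "exponent HC \<alpha> \<beta> \<gamma> \<eta> = 2 - \<alpha> / 2"

definition best_exponent :: "real \<Rightarrow> real \<Rightarrow> real \<Rightarrow> real \<Rightarrow> real" where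
  "best_exponent \<alpha> \<beta> \<gamma> \<eta> =
    Max {exponent ISH \<alpha> \<beta> \<gamma> \<eta>, exponent IMH \<alpha> \<beta> \<gamma> \<eta>, exponent MH \<alpha> \<beta> \<gamma> \<eta>, exponent HC \<alpha> \<beta> \<gamma> \<eta>}"

text \<open>A table entry "\<open>e = v\<close> (\<open>s\<close>)": the best exponent is \<open>v\<close> and scheme \<open>s\<close> attains it;
  other schemes may tie.\<close>

definition attained :: "real \<Rightarrow> real \<Rightarrow> real \<Rightarrow> real \<Rightarrow> real \<Rightarrow> scheme \<Rightarrow> bool" where
  "attained \<alpha> \<beta> \<gamma> \<eta> v s \<longleftrightarrow> best_exponent \<alpha> \<beta> \<gamma> \<eta> = v \<and> exponent s \<alpha> \<beta> \<gamma> \<eta> = v"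

datatype regime = Regime_A | Regime_B | Regime_C | Regime_D | Regime_B_tilde | Regime_D_tilde

text \<open>Each \<open>\<alpha>\<close>-interval is intersected with \<open>\<alpha> > 2\<close>, and may be empty. The quotient
  \<open>2 * (1 - \<gamma>) / \<beta>\<close> in Regime D is meaningful only for \<open>\<beta> \<noteq> 0\<close>; the classification below
  assigns Regime D only to such \<open>\<beta>\<close>, since \<open>\<gamma> < 1\<close>.\<close>

fun of_regime :: "regime \<Rightarrow> real \<Rightarrow> real \<Rightarrow> real \<Rightarrow> bool" where
  "of_regime Regime_A \<beta> \<gamma> \<eta> \<longleftrightarrow> (\<forall>\<alpha>>2.
     (\<alpha> < 3 \<longrightarrow> attained \<alpha> \<beta> \<gamma> \<eta> (2 - \<alpha> / 2) HC) \<and>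
     (3 \<le> \<alpha> \<longrightarrow> attained \<alpha> \<beta> \<gamma> \<eta> (1 / 2) MH))"
| "of_regime Regime_B \<beta> \<gamma> \<eta> \<longleftrightarrow> (\<forall>\<alpha>>2.
     (\<alpha> < 4 - 2 * \<beta> - 2 * \<gamma> \<longrightarrow> attained \<alpha> \<beta> \<gamma> \<eta> (2 - \<alpha> / 2) HC) \<and>
     (4 - 2 * \<beta> - 2 * \<gamma> \<le> \<alpha> \<longrightarrow> attained \<alpha> \<beta> \<gamma> \<eta> (\<beta> + \<gamma>) IMH))"
| "of_regime Regime_C \<beta> \<gamma> \<eta> \<longleftrightarrow> (\<forall>\<alpha>>2.
     (\<alpha> < 3 - \<beta> \<longrightarrow> attained \<alpha> \<beta> \<gamma> \<eta> (2 - \<alpha> / 2) HC) \<and>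
     (3 - \<beta> \<le> \<alpha> \<longrightarrow> attained \<alpha> \<beta> \<gamma> \<eta> ((1 + \<beta>) / 2) IMH))"
| "of_regime Regime_D \<beta> \<gamma> \<eta> \<longleftrightarrow> (\<forall>\<alpha>>2.
     (\<alpha> < 2 * (1 - \<gamma>) / \<beta> \<longrightarrow> attained \<alpha> \<beta> \<gamma> \<eta> (2 - \<alpha> / 2) HC) \<and>
     (2 * (1 - \<gamma>) / \<beta> \<le> \<alpha> \<and> \<alpha> < 1 + 2 * \<gamma> / (1 - \<beta>) \<longrightarrow>
        attained \<alpha> \<beta> \<gamma> \<eta> (1 + \<gamma> - \<alpha> * (1 - \<beta>) / 2) ISH) \<and>
     (1 + 2 * \<gamma> / (1 - \<beta>) \<le> \<alpha> \<longrightarrow> attained \<alpha> \<beta> \<gamma> \<eta> ((1 + \<beta>) / 2) IMH))"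
| "of_regime Regime_B_tilde \<beta> \<gamma> \<eta> \<longleftrightarrow> (\<forall>\<alpha>>2.
     (\<alpha> < 4 - 2 * \<beta> - 2 * \<eta> \<longrightarrow> attained \<alpha> \<beta> \<gamma> \<eta> (2 - \<alpha> / 2) HC) \<and>
     (4 - 2 * \<beta> - 2 * \<eta> \<le> \<alpha> \<longrightarrow> attained \<alpha> \<beta> \<gamma> \<eta> (\<beta> + \<eta>) IMH))"
| "of_regime Regime_D_tilde \<beta> \<gamma> \<eta> \<longleftrightarrow> (\<forall>\<alpha>>2.
     (\<alpha> < 4 - 2 * \<beta> - 2 * \<eta> \<longrightarrow> attained \<alpha> \<beta> \<gamma> \<eta> (2 - \<alpha> / 2) HC) \<and>
     (4 - 2 * \<beta> - 2 * \<eta> \<le> \<alpha> \<and> \<alpha> < 2 + 2 * (\<gamma> - \<eta>) / (1 - \<beta>) \<longrightarrow>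
        attained \<alpha> \<beta> \<gamma> \<eta> (\<beta> + \<eta>) ISH) \<and>
     (2 + 2 * (\<gamma> - \<eta>) / (1 - \<beta>) \<le> \<alpha> \<and> \<alpha> < 1 + 2 * \<gamma> / (1 - \<beta>) \<longrightarrow>
        attained \<alpha> \<beta> \<gamma> \<eta> (1 + \<gamma> - \<alpha> * (1 - \<beta>) / 2) ISH) \<and>
     (1 + 2 * \<gamma> / (1 - \<beta>) \<le> \<alpha> \<longrightarrow> attained \<alpha> \<beta> \<gamma> \<eta> ((1 + \<beta>) / 2) IMH))"

fun infinite_capacity_class :: "regime \<Rightarrow> real \<Rightarrow> real \<Rightarrow> bool" where
  "infinite_capacity_class Regime_A \<beta> \<gamma> \<longleftrightarrow> \<beta> + \<gamma> < 1 / 2"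
| "infinite_capacity_class Regime_B \<beta> \<gamma> \<longleftrightarrow> \<beta> + \<gamma> \<ge> 1 / 2 \<and> \<beta> + 2 * \<gamma> < 1"
| "infinite_capacity_class Regime_C \<beta> \<gamma> \<longleftrightarrow>
     \<beta> + 2 * \<gamma> \<ge> 1 \<and> \<gamma> < 1 / 2 * (\<beta>\<^sup>2 - 3 * \<beta> + 2)"
| "infinite_capacity_class Regime_D \<beta> \<gamma> \<longleftrightarrow> \<gamma> \<ge> 1 / 2 * (\<beta>\<^sup>2 - 3 * \<beta> + 2)"
| "infinite_capacity_class Regime_B_tilde \<beta> \<gamma> \<longleftrightarrow> False"
| "infinite_capacity_class Regime_D_tilde \<beta> \<gamma> \<longleftrightarrow> False"

text \<open>The uniqueness clause makes "the regime given by the infinite-capacity classification"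
  well defined, so that the second clause cannot hold vacuously.\<close>

definition of_infinite_capacity_regime :: "real \<Rightarrow> real \<Rightarrow> real \<Rightarrow> bool" where
  "of_infinite_capacity_regime \<beta> \<gamma> \<eta> \<longleftrightarrow>
     (\<exists>!r. infinite_capacity_class r \<beta> \<gamma>) \<and>
     (\<forall>r. infinite_capacity_class r \<beta> \<gamma> \<longrightarrow> of_regime r \<beta> \<gamma> \<eta>)"

end

theory Submission imports Defs begin

text \<open>In each regime every table entry amounts to comparing the four exponents, which are monotone
  in \<open>\<alpha>\<close>, at the endpoint of an interval. The two curves in the classification arise as follows:
  at the crossing point of HC and ISH, \<open>\<alpha> = 2 * (1 - \<gamma>) / \<beta>\<close>, the common value \<open>(2 * \<beta> - 1 + \<gamma>) / \<beta>\<close>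
  reaches \<open>(1 + \<beta>) / 2\<close> iff \<open>2 * \<gamma> \<ge> (1 - \<beta>) * (2 - \<beta>)\<close>, and reaches the backhaul limit \<open>\<beta> + \<eta>\<close>
  iff \<open>\<gamma> \<ge> (1 - \<beta>)\<^sup>2 + \<eta> * \<beta>\<close>.\<close>

section \<open>Table entries as inequalities between exponents\<close>

lemma all_scheme: "(\<forall>s. P s) \<longleftrightarrow> P ISH \<and> P IMH \<and> P MH \<and> P HC"
  by (metis scheme.exhaust)

lemma attained_iff:
  "attained \<alpha> \<beta> \<gamma> \<eta> v s \<longleftrightarrow>
     exponent s \<alpha> \<beta> \<gamma> \<eta> = v \<and> (\<forall>s'. exponent s' \<alpha> \<beta> \<gamma> \<eta> \<le> v)"
  unfolding attained_def best_exponent_def all_scheme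
  by (cases s) (auto simp: max_def simp del: exponent.simps)

text \<open>A minimum lies below a bound as soon as one of its arguments does; hence the
  disjunctions, which let each regime name the binding argument. The bound
  \<open>\<alpha> \<le> 3\<close> is the comparison with MH.\<close>

lemma attained_HC:
  assumes "1 + \<gamma> - \<alpha> * (1 - \<beta>) / 2 \<le> 2 - \<alpha> / 2 \<or> \<beta> + \<eta> \<le> 2 - \<alpha> / 2"
    and "\<beta> + \<gamma> \<le> 2 - \<alpha> / 2 \<or> (1 + \<beta>) / 2 \<le> 2 - \<alpha> / 2 \<or> \<beta> + \<eta> \<le> 2 - \<alpha> / 2"
    and "\<alpha> \<le> 3"
  shows "attained \<alpha> \<beta> \<gamma> \<eta> (2 - \<alpha> / 2) HC"
  using assms by (auto simp: attained_iff all_scheme min_def)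

lemma attained_MH:
  assumes "1 + \<gamma> - \<alpha> * (1 - \<beta>) / 2 \<le> 1 / 2 \<or> \<beta> + \<eta> \<le> 1 / 2"
    and "\<beta> + \<gamma> \<le> 1 / 2 \<or> \<beta> + \<eta> \<le> 1 / 2"
    and "3 \<le> \<alpha>"
  shows "attained \<alpha> \<beta> \<gamma> \<eta> (1 / 2) MH"
  using assms by (auto simp: attained_iff all_scheme min_def)

lemma attained_IMH:
  assumes "v = min (\<beta> + \<gamma>) (min ((1 + \<beta>) / 2) (\<beta> + \<eta>))"
    and "1 + \<gamma> - \<alpha> * (1 - \<beta>) / 2 \<le> v \<or> \<beta> + \<eta> \<le> v"
    and "1 / 2 \<le> v" and "2 - \<alpha> / 2 \<le> v"
  shows "attained \<alpha> \<beta> \<gamma> \<eta> v IMH"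
  using assms by (auto simp: attained_iff all_scheme min_def)

lemma attained_ISH:
  assumes "v = min (1 + \<gamma> - \<alpha> * (1 - \<beta>) / 2) (\<beta> + \<eta>)"
    and "\<beta> + \<gamma> \<le> v \<or> (1 + \<beta>) / 2 \<le> v \<or> \<beta> + \<eta> \<le> v"
    and "1 / 2 \<le> v" and "2 - \<alpha> / 2 \<le> v"
  shows "attained \<alpha> \<beta> \<gamma> \<eta> v ISH"
  using assms by (auto simp: attained_iff all_scheme min_def)

section \<open>Boundary curves and monotonicity in \<alpha>\<close>

lemma curve_C_D_factor: "1 / 2 * (\<beta>\<^sup>2 - 3 * \<beta> + 2) = (1 - \<beta>) * (2 - \<beta>) / (2 :: real)"
  by (simp add: field_simps power2_eq_square)

lemma curve_D_tilde_factor: "\<beta>\<^sup>2 + (\<eta> - 2) * \<beta> + 1 = (1 - \<beta>)\<^sup>2 + \<eta> * (\<beta> :: real)"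
  by (simp add: algebra_simps power2_eq_square)

text \<open>HC minus uncapped ISH is \<open>1 - \<gamma> - \<alpha> * \<beta> / 2\<close>,
  nonincreasing in \<alpha>, so the right endpoint \<open>a\<close> decides.\<close>

lemma ISH_le_HC_until:
  fixes \<alpha> \<beta> \<gamma> :: real
  assumes "0 \<le> \<beta>" "\<alpha> \<le> a" "2 * \<gamma> + a * \<beta> \<le> 2"
  shows "1 + \<gamma> - \<alpha> * (1 - \<beta>) / 2 \<le> 2 - \<alpha> / 2"
  using mult_right_mono[OF assms(2,1)] assms(3) by (simp add: field_simps)

lemma ISH_le_from:
  fixes \<alpha> \<beta> \<gamma> :: real
  assumes "\<beta> < 1" "a \<le> \<alpha>" "1 + \<gamma> - a * (1 - \<beta>) / 2 \<le> v"
  shows "1 + \<gamma> - \<alpha> * (1 - \<beta>) / 2 \<le> v"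
proof -
  have "a * (1 - \<beta>) \<le> \<alpha> * (1 - \<beta>)"
    using assms(1,2) by (intro mult_right_mono) auto
  with assms(3) show ?thesis by linarith
qed

lemma regime_A_of_backhaul:
  assumes "\<beta> + \<eta> \<le> 1 / 2"
  shows "of_regime Regime_A \<beta> \<gamma> \<eta>"
  using assms by (auto intro!: attained_HC attained_MH)

text \<open>At \<alpha> = 3, where HC meets MH, the comparison of ISH with either is
  \<open>3 * \<beta> + 2 * \<gamma> \<le> 2\<close>, which follows from
  \<open>\<beta> + \<gamma> < 1 / 2\<close>.\<close>

lemma regime_A_of_antennas:
  assumes "0 \<le> \<beta>" "0 \<le> \<gamma>" "\<beta> + \<gamma> < 1 / 2"
  shows "of_regime Regime_A \<beta> \<gamma> \<eta>"
proof -
  have HC: "attained \<alpha> \<beta> \<gamma> \<eta> (2 - \<alpha> / 2) HC" if "\<alpha> < 3" for \<alpha>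
    using that assms ISH_le_HC_until[of \<beta> \<alpha> 3 \<gamma>] by (intro attained_HC) auto
  have MH: "attained \<alpha> \<beta> \<gamma> \<eta> (1 / 2) MH" if "3 \<le> \<alpha>" for \<alpha>
    using that assms ISH_le_from[of \<beta> 3 \<alpha> \<gamma> "1 / 2"]
    by (intro attained_MH disjI1) (auto simp: field_simps)
  from HC MH show ?thesis by simp
qed

text \<open>The last two hypotheses make the backhaul term the smallest in IMH. It also caps ISH, so
  ISH never beats IMH.\<close>

lemma regime_B_tilde_of_backhaul:
  assumes "1 / 2 \<le> \<beta> + \<eta>" "\<eta> \<le> \<gamma>" "\<beta> + 2 * \<eta> \<le> 1"
  shows "of_regime Regime_B_tilde \<beta> \<gamma> \<eta>"
  using assms by (auto intro!: attained_HC attained_IMH)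

lemma regime_B_of_antennas:
  assumes "0 \<le> \<beta>" "\<beta> < 1" "\<beta> + \<gamma> \<le> 1" "1 / 2 \<le> \<beta> + \<gamma>" "\<beta> + 2 * \<gamma> < 1" "\<gamma> \<le> \<eta>"
  shows "of_regime Regime_B \<beta> \<gamma> \<eta>"
proof -
  let ?a = "4 - 2 * \<beta> - 2 * \<gamma>"
  \<comment> \<open>HC and IMH meet at \<open>?a\<close>, so ISH compares with both in the same way
    there; the gaps in the two facts of \<open>cross\<close> are twice this product and the product
    itself.\<close>
  have "0 \<le> (1 - \<beta>) * (1 - \<beta> - \<gamma>)"
    using assms by simp
  then have cross: "2 * \<gamma> + ?a * \<beta> \<le> 2" "1 + \<gamma> - ?a * (1 - \<beta>) / 2 \<le> \<beta> + \<gamma>"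
    by (simp_all add: field_simps)
  have HC: "attained \<alpha> \<beta> \<gamma> \<eta> (2 - \<alpha> / 2) HC" if "\<alpha> < ?a" for \<alpha>
    using that assms cross(1) ISH_le_HC_until[of \<beta> \<alpha> ?a \<gamma>] by (intro attained_HC) auto
  have IMH: "attained \<alpha> \<beta> \<gamma> \<eta> (\<beta> + \<gamma>) IMH" if "?a \<le> \<alpha>" for \<alpha>
    using that assms ISH_le_from[of \<beta> ?a \<alpha> \<gamma>, OF _ _ cross(2)] by (intro attained_IMH) auto
  from HC IMH show ?thesis by simp
qed

text \<open>HC falls to \<open>(1 + \<beta>) / 2\<close> at \<open>3 - \<beta>\<close>, and the
  bound on \<gamma> says that ISH is no better at that point. Monotonicity then keeps ISH below HC
  to the left and below IMH to the right.\<close>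

lemma regime_C_of_antennas:
  assumes "0 \<le> \<beta>" "\<beta> < 1" "1 \<le> \<beta> + 2 * \<gamma>" "1 \<le> \<beta> + 2 * \<eta>"
    and "2 * \<gamma> \<le> (1 - \<beta>) * (2 - \<beta>)"
  shows "of_regime Regime_C \<beta> \<gamma> \<eta>"
proof -
  have cross: "2 * \<gamma> + (3 - \<beta>) * \<beta> \<le> 2" "1 + \<gamma> - (3 - \<beta>) * (1 - \<beta>) / 2 \<le> (1 + \<beta>) / 2"
    using assms(5) by (simp_all add: field_simps)
  have HC: "attained \<alpha> \<beta> \<gamma> \<eta> (2 - \<alpha> / 2) HC" if "\<alpha> < 3 - \<beta>" for \<alpha>
    using that assms cross(1) ISH_le_HC_until[of \<beta> \<alpha> "3 - \<beta>" \<gamma>] by (intro attained_HC) auto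
  have IMH: "attained \<alpha> \<beta> \<gamma> \<eta> ((1 + \<beta>) / 2) IMH" if "3 - \<beta> \<le> \<alpha>" for \<alpha>
    using that assms ISH_le_from[of \<beta> "3 - \<beta>" \<alpha> \<gamma>, OF _ _ cross(2)] by (intro attained_IMH) auto
  from HC IMH show ?thesis by simp
qed

section \<open>Regimes with an ISH interval\<close>

lemma ISH_IMH_crossing:
  fixes \<alpha> \<beta> \<gamma> :: real
  assumes "\<beta> < 1"
  shows "\<alpha> \<le> 1 + 2 * \<gamma> / (1 - \<beta>) \<longleftrightarrow> (1 + \<beta>) / 2 \<le> 1 + \<gamma> - \<alpha> * (1 - \<beta>) / 2"
    and "1 + 2 * \<gamma> / (1 - \<beta>) \<le> \<alpha> \<longleftrightarrow> 1 + \<gamma> - \<alpha> * (1 - \<beta>) / 2 \<le> (1 + \<beta>) / 2"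
  using assms by (intro iffI; simp add: field_simps)+

text \<open>On or above the C/D curve, ISH is still at least \<open>(1 + \<beta>) / 2\<close> when
  HC reaches that value. Hence HC is out of play once IMH takes over from ISH.\<close>

lemma ISH_IMH_crossing_ge:
  fixes \<beta> \<gamma> :: real
  assumes "\<beta> < 1" "(1 - \<beta>) * (2 - \<beta>) \<le> 2 * \<gamma>"
  shows "3 - \<beta> \<le> 1 + 2 * \<gamma> / (1 - \<beta>)"
  using assms by (simp add: field_simps)

lemma antenna_lower_bound:
  fixes \<beta> \<gamma> :: real
  assumes "0 \<le> \<beta>" "\<beta> < 1" "(1 - \<beta>) * (2 - \<beta>) \<le> 2 * \<gamma>"
  shows "1 \<le> \<beta> + 2 * \<gamma>"
proof -
  have "(1 - \<beta>) * 1 \<le> (1 - \<beta>) * (2 - \<beta>)"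
    using assms(1,2) by (intro mult_left_mono) auto
  also note assms(3)
  finally show ?thesis by simp
qed

text \<open>The last row shared by the tables of Regimes D and D tilde.\<close>

lemma IMH_after_ISH:
  assumes "0 \<le> \<beta>" "\<beta> < 1" "1 \<le> \<beta> + 2 * \<gamma>" "1 \<le> \<beta> + 2 * \<eta>"
    and "(1 - \<beta>) * (2 - \<beta>) \<le> 2 * \<gamma>" "1 + 2 * \<gamma> / (1 - \<beta>) \<le> \<alpha>"
  shows "attained \<alpha> \<beta> \<gamma> \<eta> ((1 + \<beta>) / 2) IMH"
proof (rule attained_IMH)
  show "1 + \<gamma> - \<alpha> * (1 - \<beta>) / 2 \<le> (1 + \<beta>) / 2 \<or> \<beta> + \<eta> \<le> (1 + \<beta>) / 2"
    using ISH_IMH_crossing(2) assms by blast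
  show "2 - \<alpha> / 2 \<le> (1 + \<beta>) / 2"
    using ISH_IMH_crossing_ge[of \<beta> \<gamma>] assms by simp
qed (use assms in auto)

lemma regime_D_of_antennas:
  assumes "0 < \<beta>" "\<beta> < 1" "1 \<le> \<beta> + 2 * \<eta>"
    and lower: "(1 - \<beta>) * (2 - \<beta>) \<le> 2 * \<gamma>"
    and upper: "\<gamma> \<le> (1 - \<beta>)\<^sup>2 + \<eta> * \<beta>"
  shows "of_regime Regime_D \<beta> \<gamma> \<eta>"
proof -
  let ?a = "2 * (1 - \<gamma>) / \<beta>"
  have g: "1 \<le> \<beta> + 2 * \<gamma>"
    using antenna_lower_bound assms by simp
  have HC: "attained \<alpha> \<beta> \<gamma> \<eta> (2 - \<alpha> / 2) HC" if "\<alpha> < ?a" for \<alpha>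
  proof -
    \<comment> \<open>This is \<open>lower\<close> multiplied out: left of \<open>?a\<close>, HC has
      not yet dropped below the IMH value \<open>(1 + \<beta>) / 2\<close>.\<close>
    have "?a \<le> 3 - \<beta>"
      using assms by (simp add: field_simps)
    then show ?thesis
      using that assms ISH_le_HC_until[of \<beta> \<alpha> ?a \<gamma>] by (intro attained_HC) auto
  qed
  have ISH: "attained \<alpha> \<beta> \<gamma> \<eta> (1 + \<gamma> - \<alpha> * (1 - \<beta>) / 2) ISH"
    if "?a \<le> \<alpha>" "\<alpha> < 1 + 2 * \<gamma> / (1 - \<beta>)" for \<alpha>
  proof -
    \<comment> \<open>Multiplied by \<beta>, this is \<open>upper\<close>: the backhaul cap on ISH
      does not bind when ISH overtakes HC, nor later, as ISH decreases.\<close>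
    have "1 + \<gamma> - ?a * (1 - \<beta>) / 2 \<le> \<beta> + \<eta>"
      using upper \<open>0 < \<beta>\<close> by (simp add: field_simps power2_eq_square)
    then have "1 + \<gamma> - \<alpha> * (1 - \<beta>) / 2 \<le> \<beta> + \<eta>"
      by (rule ISH_le_from[OF assms(2) that(1)])
    moreover have "2 - \<alpha> / 2 \<le> 1 + \<gamma> - \<alpha> * (1 - \<beta>) / 2"
      using that \<open>0 < \<beta>\<close> by (simp add: field_simps)
    moreover have "(1 + \<beta>) / 2 \<le> 1 + \<gamma> - \<alpha> * (1 - \<beta>) / 2"
      using ISH_IMH_crossing(1) that(2) assms(2) less_imp_le by blast
    ultimately show ?thesis
      using assms by (intro attained_ISH) auto
  qed
  show ?thesis
    using HC ISH IMH_after_ISH[OF _ _ g] assms by simp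
qed

text \<open>Twice the D tilde curve is at least
  \<open>2 * (1 - \<beta>)\<^sup>2 + (1 - \<beta>) * \<beta>\<close>, which factors as
  \<open>(1 - \<beta>) * (2 - \<beta>)\<close>.\<close>

lemma curve_D_tilde_above_curve_C_D:
  fixes \<beta> \<gamma> \<eta> :: real
  assumes "0 \<le> \<beta>" "1 \<le> \<beta> + 2 * \<eta>" "(1 - \<beta>)\<^sup>2 + \<eta> * \<beta> \<le> \<gamma>"
  shows "(1 - \<beta>) * (2 - \<beta>) \<le> 2 * \<gamma>"
proof -
  have "(1 - \<beta>) * \<beta> \<le> 2 * \<eta> * \<beta>"
    using assms by (intro mult_right_mono) auto
  then show ?thesis
    using assms(3) by (simp add: algebra_simps power2_eq_square)
qed

lemma regime_D_tilde_of_antennas: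
  assumes "0 \<le> \<beta>" "\<beta> < 1" "1 \<le> \<beta> + 2 * \<eta>"
    and lower: "(1 - \<beta>)\<^sup>2 + \<eta> * \<beta> \<le> \<gamma>"
  shows "of_regime Regime_D_tilde \<beta> \<gamma> \<eta>"
proof -
  let ?a = "2 + 2 * (\<gamma> - \<eta>) / (1 - \<beta>)"
  have CD: "(1 - \<beta>) * (2 - \<beta>) \<le> 2 * \<gamma>"
    using curve_D_tilde_above_curve_C_D assms by simp
  then have g: "1 \<le> \<beta> + 2 * \<gamma>"
    using antenna_lower_bound assms by simp
  have h: "1 / 2 \<le> \<beta> + \<eta>"
    using assms by simp
  \<comment> \<open>The cap \<open>\<beta> + \<eta>\<close> alone keeps both infrastructure schemes
    below HC here.\<close>
  have HC: "attained \<alpha> \<beta> \<gamma> \<eta> (2 - \<alpha> / 2) HC" if "\<alpha> < 4 - 2 * \<beta> - 2 * \<eta>" for \<alpha>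
    using that h by (intro attained_HC) auto
  have flat: "attained \<alpha> \<beta> \<gamma> \<eta> (\<beta> + \<eta>) ISH" if "4 - 2 * \<beta> - 2 * \<eta> \<le> \<alpha>" "\<alpha> < ?a" for \<alpha>
  proof -
    have "\<beta> + \<eta> \<le> 1 + \<gamma> - \<alpha> * (1 - \<beta>) / 2"
      using that(2) \<open>\<beta> < 1\<close> by (simp add: field_simps)
    then show ?thesis
      using that h by (intro attained_ISH) auto
  qed
  have slope: "attained \<alpha> \<beta> \<gamma> \<eta> (1 + \<gamma> - \<alpha> * (1 - \<beta>) / 2) ISH"
    if "?a \<le> \<alpha>" "\<alpha> < 1 + 2 * \<gamma> / (1 - \<beta>)" for \<alpha>
  proof -
    \<comment> \<open>Uncapped ISH falls to \<open>\<beta> + \<eta>\<close> at \<open>?a\<close>. By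
      \<open>lower\<close>, HC is no larger there; the product form avoids dividing by
      \<beta>.\<close>
    have "2 - 2 * \<gamma> \<le> ?a * \<beta>"
      using lower \<open>\<beta> < 1\<close> by (simp add: field_simps power2_eq_square)
    also have "\<dots> \<le> \<alpha> * \<beta>"
      using that(1) \<open>0 \<le> \<beta>\<close> by (rule mult_right_mono)
    finally have "2 - \<alpha> / 2 \<le> 1 + \<gamma> - \<alpha> * (1 - \<beta>) / 2"
      by (simp add: field_simps)
    moreover have "1 + \<gamma> - \<alpha> * (1 - \<beta>) / 2 \<le> \<beta> + \<eta>"
      using that(1) \<open>\<beta> < 1\<close> by (simp add: field_simps)
    moreover have "(1 + \<beta>) / 2 \<le> 1 + \<gamma> - \<alpha> * (1 - \<beta>) / 2"
      using ISH_IMH_crossing(1) that(2) assms(2) less_imp_le by blast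
    ultimately show ?thesis
      using assms by (intro attained_ISH) auto
  qed
  show ?thesis
    using HC flat slope IMH_after_ISH[OF _ _ g _ CD] assms by simp
qed

section \<open>The infinite-capacity classification\<close>

lemma infinite_capacity_class_ex1:
  assumes "0 \<le> \<beta>" "\<beta> < 1" "0 \<le> \<gamma>"
  shows "\<exists>!r. infinite_capacity_class r \<beta> \<gamma>"
proof -
  \<comment> \<open>Separates Regime D from A and B, whose conditions force
    \<open>\<beta> + 2 * \<gamma> < 1\<close>.\<close>
  have D: "1 \<le> \<beta> + 2 * \<gamma>" if "infinite_capacity_class Regime_D \<beta> \<gamma>"
    using antenna_lower_bound[of \<beta> \<gamma>] that assms
    unfolding infinite_capacity_class.simps curve_C_D_factor by simp
  have uniq: "r = r'" if "infinite_capacity_class r \<beta> \<gamma>" "infinite_capacity_class r' \<beta> \<gamma>" for r r'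
    using that D assms by (cases r; cases r') auto
  have "\<exists>r. infinite_capacity_class r \<beta> \<gamma>"
  proof (cases "\<beta> + 2 * \<gamma> < 1")
    case True
    then have "infinite_capacity_class (if \<beta> + \<gamma> < 1 / 2 then Regime_A else Regime_B) \<beta> \<gamma>"
      by simp
    then show ?thesis ..
  next
    case False
    then have "infinite_capacity_class
      (if \<gamma> < 1 / 2 * (\<beta>\<^sup>2 - 3 * \<beta> + 2) then Regime_C else Regime_D) \<beta> \<gamma>"
      by simp
    then show ?thesis ..
  qed
  with uniq show ?thesis by blast
qed

lemma infinite_capacity_regime:
  assumes "0 \<le> \<beta>" "\<beta> < 1" "0 \<le> \<gamma>" "\<gamma> < 1" "\<beta> + \<gamma> \<le> 1"
    and "1 \<le> \<beta> + 2 * \<eta>" and "\<beta> + 2 * \<gamma> < 1 \<Longrightarrow> \<gamma> \<le> \<eta>"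
    and "\<gamma> \<le> (1 - \<beta>)\<^sup>2 + \<eta> * \<beta>"
  shows "of_infinite_capacity_regime \<beta> \<gamma> \<eta>"
proof -
  have "of_regime r \<beta> \<gamma> \<eta>" if r: "infinite_capacity_class r \<beta> \<gamma>" for r
  proof (cases r)
    case Regime_A
    with r assms regime_A_of_antennas show ?thesis by simp
  next
    case Regime_B
    with r assms regime_B_of_antennas show ?thesis by simp
  next
    case Regime_C
    with r assms regime_C_of_antennas show ?thesis
      unfolding Regime_C infinite_capacity_class.simps curve_C_D_factor by simp
  next
    case Regime_D
    with r have CD: "(1 - \<beta>) * (2 - \<beta>) \<le> 2 * \<gamma>"
      unfolding Regime_D infinite_capacity_class.simps curve_C_D_factor by simp
    \<comment> \<open>At \<beta> = 0, \<open>CD\<close> would read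
      \<open>2 \<le> 2 * \<gamma>\<close>, contrary to \<open>\<gamma> < 1\<close>.\<close>
    with assms have "0 < \<beta>"
      by (cases "\<beta> = 0") auto
    with Regime_D CD assms regime_D_of_antennas show ?thesis by blast
  qed (use r in auto)
  with infinite_capacity_class_ex1 assms show ?thesis
    unfolding of_infinite_capacity_regime_def by blast
qed

text \<open>For \<open>1 \<le> \<eta>\<close> the D tilde curve lies on or above the line
  \<open>\<beta> + \<gamma> = 1\<close>, which is why the last range of \<eta> has no D tilde
  case.\<close>

lemma curve_D_tilde_ge_of_one_le:
  fixes \<beta> \<gamma> \<eta> :: real
  assumes "0 \<le> \<beta>" "\<beta> + \<gamma> \<le> 1" "1 \<le> \<eta>"
  shows "\<gamma> \<le> (1 - \<beta>)\<^sup>2 + \<eta> * \<beta>"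
proof -
  have "\<gamma> \<le> (1 - \<beta>) + \<beta>\<^sup>2"
    using assms(2) by (simp add: add_increasing2)
  also have "\<dots> = (1 - \<beta>)\<^sup>2 + 1 * \<beta>"
    by (simp add: power2_eq_square algebra_simps)
  also have "\<dots> \<le> (1 - \<beta>)\<^sup>2 + \<eta> * \<beta>"
    using mult_right_mono[OF assms(3,1)] by simp
  finally show ?thesis .
qed

theorem mainTheorem4:
  fixes \<beta> \<gamma> \<eta> :: real
  assumes "0 \<le> \<beta>" "\<beta> < 1" "0 \<le> \<gamma>" "\<gamma> < 1" "\<beta> + \<gamma> \<le> 1"
  shows
    "(\<eta> < - (1 / 2) \<longrightarrow> of_regime Regime_A \<beta> \<gamma> \<eta>) \<and>
     (- (1 / 2) \<le> \<eta> \<and> \<eta> < 0 \<longrightarrow>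
        (\<beta> < 1 / 2 - \<eta> \<longrightarrow> of_regime Regime_A \<beta> \<gamma> \<eta>) \<and>
        (\<beta> \<ge> 1 / 2 - \<eta> \<longrightarrow> of_regime Regime_B_tilde \<beta> \<gamma> \<eta>)) \<and>
     (0 \<le> \<eta> \<and> \<eta> < 1 / 2 \<longrightarrow>
        (\<beta> + \<gamma> < 1 / 2 \<longrightarrow> of_regime Regime_A \<beta> \<gamma> \<eta>) \<and>
        (\<beta> + \<gamma> \<ge> 1 / 2 \<longrightarrow>
           (\<gamma> > \<eta> \<and> \<beta> < 1 - 2 * \<eta> \<longrightarrow>
              (\<beta> < 1 / 2 - \<eta> \<longrightarrow> of_regime Regime_A \<beta> \<gamma> \<eta>) \<and>
              (\<beta> \<ge> 1 / 2 - \<eta> \<longrightarrow> of_regime Regime_B_tilde \<beta> \<gamma> \<eta>)) \<and>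
           (\<gamma> \<le> \<eta> \<and> \<beta> + 2 * \<gamma> < 1 \<longrightarrow> of_regime Regime_B \<beta> \<gamma> \<eta>) \<and>
           (\<beta> + 2 * \<gamma> \<ge> 1 \<and> \<beta> \<ge> 1 - 2 * \<eta> \<and> \<gamma> \<ge> \<beta>\<^sup>2 + (\<eta> - 2) * \<beta> + 1 \<longrightarrow>
              of_regime Regime_D_tilde \<beta> \<gamma> \<eta>) \<and>
           (\<beta> + 2 * \<gamma> \<ge> 1 \<and> \<beta> \<ge> 1 - 2 * \<eta> \<and> \<gamma> < \<beta>\<^sup>2 + (\<eta> - 2) * \<beta> + 1 \<longrightarrow>
              of_infinite_capacity_regime \<beta> \<gamma> \<eta>))) \<and>
     (1 / 2 \<le> \<eta> \<and> \<eta> < 1 \<longrightarrow>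
        (\<gamma> \<ge> \<beta>\<^sup>2 + (\<eta> - 2) * \<beta> + 1 \<longrightarrow> of_regime Regime_D_tilde \<beta> \<gamma> \<eta>) \<and>
        (\<not> \<gamma> \<ge> \<beta>\<^sup>2 + (\<eta> - 2) * \<beta> + 1 \<longrightarrow> of_infinite_capacity_regime \<beta> \<gamma> \<eta>)) \<and>
     (1 \<le> \<eta> \<longrightarrow> of_infinite_capacity_regime \<beta> \<gamma> \<eta>)"
proof -
  note A = regime_A_of_backhaul[of \<beta> \<eta> \<gamma>] regime_A_of_antennas[OF assms(1,3), of \<eta>]
  note B_tilde = regime_B_tilde_of_backhaul[of \<beta> \<eta> \<gamma>]
  note B = regime_B_of_antennas[OF assms(1,2,5), of \<eta>]
  note D_tilde = regime_D_tilde_of_antennas[OF assms(1,2), of \<eta> \<gamma>]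
  note inf = infinite_capacity_regime[OF assms, of \<eta>]
  note above = curve_D_tilde_ge_of_one_le[OF assms(1,5), of \<eta>]
  \<comment> \<open>With the curve in factored form, each case is an instance of one regime lemma,
    and its side conditions are linear once the curve's nonlinear terms are treated as
    atoms.\<close>
  show ?thesis
    unfolding curve_D_tilde_factor
    by (intro conjI impI; (elim conjE)?; insert assms above;
        (rule A B_tilde B D_tilde inf; linarith)+)
qed

end
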